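(* Let $\varphi\in\operatorname{LFM}(B_2)$ be elliptic and let $z_0\in B_2$ be a fixed point of $\varphi$. If $\rho(\varphi'(z_0))=1$, then there is a semigroup $\{\varphi_t\}$ of linear fractional maps of $B_2$ such that $\varphi_1=\varphi$.
   Context: $B_N$ is the open unit ball of $\mathbb{C}^N$. A holomorphic map is linear fractional if it has the form $z\mapsto \frac{Az+B}{\langle z,C\rangle+D}$ with $A\in\mathbb{C}^{N\times N}$, $B,C\in\mathbb{C}^N$, $D\in\mathbb{C}$; $\operatorname{LFM}(B_N)$ is the set of linear fractional self-maps of $B_N$. A holomorphic self-map of $B_N$ is elliptic if it has at least one fixed point in $B_N$. $\rho$ denotes the spectral radius and $\varphi'(z_0)$ the complex Jacobian matrix. A (continuous) semigroup $\{\varphi_t\}_{t\ge0}$ on a domain $D$ is a continuous homomorphism from the additive semigroup of non-negative reals into the composition semigroup of holomorphic self-maps of $D$ with the compact-open topology (so $\varphi_0=\mathrm{id}$, $\varphi_{t+s}=\varphi_t\circ\varphi_s$).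
   Formalization: The map φ is additionally assumed injective on B_2; without this the claim fails, e.g. for φ(z1,z2) = (z1,0), since every member of a continuous semigroup of holomorphic self-maps is injective. *)

theory Defs
  imports "HOL-Analysis.Analysis"
begin

section \<open>Holomorphic self-maps and their semigroups\<close>

text \<open>Holomorphic maps are total functions of which only the values on the domain matter.
  They are Frechet differentiable with a complex-linear derivative, that is, one given by
  a complex matrix. For such a map, the library's \<^const>\<open>jacobian\<close> at a point is the complex
  Jacobian matrix: column \<open>j\<close> is the Frechet derivative applied to the \<open>j\<close>-th unit vector.\<close>

definition holomorphic_map_on :: "(complex ^ 'n) set \<Rightarrow> (complex ^ 'n \<Rightarrow> complex ^ 'm) \<Rightarrow> bool"
  where "holomorphic_map_on D f \<longleftrightarrow>
    (\<forall>z\<in>D. \<exists>M :: complex ^ 'n ^ 'm. (f has_derivative (\<lambda>h. M *v h)) (at z))"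

definition holomorphic_self_map :: "(complex ^ 'n) set \<Rightarrow> (complex ^ 'n \<Rightarrow> complex ^ 'n) \<Rightarrow> bool"
  where "holomorphic_self_map D f \<longleftrightarrow> holomorphic_map_on D f \<and> f ` D \<subseteq> D"

definition compact_open :: "'a::topological_space set \<Rightarrow> ('a \<Rightarrow> 'b::topological_space) topology"
  where "compact_open D =
    topology_generated_by {{f. f ` K \<subseteq> U} | K U. compact K \<and> K \<subseteq> D \<and> open U}"

definition semigroup_on :: "(complex ^ 'n) set \<Rightarrow> (real \<Rightarrow> complex ^ 'n \<Rightarrow> complex ^ 'n) \<Rightarrow> bool"
  where "semigroup_on D \<Phi> \<longleftrightarrow>
    continuous_map (top_of_set {0..})
      (subtopology (compact_open D) {f. holomorphic_self_map D f}) \<Phi> \<and>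
    (\<forall>z\<in>D. \<Phi> 0 z = z) \<and>
    (\<forall>s\<ge>0. \<forall>t\<ge>0. \<forall>z\<in>D. \<Phi> (t + s) z = \<Phi> t (\<Phi> s z))"


section \<open>The unit ball, linear fractional maps and the spectral radius\<close>

text \<open>The norm of \<^typ>\<open>complex ^ 'n\<close> is the Hermitian one, so this is the Euclidean ball.\<close>

abbreviation unit_ball :: "(complex ^ 'n) set"
  where "unit_ball \<equiv> ball 0 1"

definition elliptic :: "(complex ^ 'n \<Rightarrow> complex ^ 'n) \<Rightarrow> bool"
  where "elliptic f \<longleftrightarrow> holomorphic_self_map unit_ball f \<and> (\<exists>z\<in>unit_ball. f z = z)"

definition hermitian :: "complex ^ 'n \<Rightarrow> complex ^ 'n \<Rightarrow> complex"
  where "hermitian z w = (\<Sum>i\<in>UNIV. z $ i * cnj (w $ i))"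

text \<open>Since \<open>x / 0 = 0\<close> in HOL, the denominator is required explicitly to have no zero on
  the domain.\<close>

definition linear_fractional_on :: "(complex ^ 'n) set \<Rightarrow> (complex ^ 'n \<Rightarrow> complex ^ 'n) \<Rightarrow> bool"
  where "linear_fractional_on D f \<longleftrightarrow>
    (\<exists>(A :: complex ^ 'n ^ 'n) B C d. \<forall>z\<in>D. hermitian z C + d \<noteq> 0 \<and>
       f z = inverse (hermitian z C + d) *s (A *v z + B))"

definition LFM :: "(complex ^ 'n \<Rightarrow> complex ^ 'n) set"
  where "LFM = {f. linear_fractional_on unit_ball f \<and> holomorphic_self_map unit_ball f}"

definition spectrum :: "complex ^ 'n ^ 'n \<Rightarrow> complex set"
  where "spectrum M = {c. \<exists>v. v \<noteq> 0 \<and> M *v v = c *s v}"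

definition spectral_radius :: "complex ^ 'n ^ 'n \<Rightarrow> real"
  where "spectral_radius M = Max (cmod ` spectrum M)"

end

theory Submission
  imports Defs "HOL-Computational_Algebra.Fundamental_Theorem_Algebra"
begin

text \<open>Conjugating by the involutive automorphism of the ball that exchanges \<open>z0\<close> and \<open>0\<close>, one may
  assume that the fixed point is \<open>0\<close>, so that \<open>\<phi> z = M z / (\<langle>z, C\<rangle> + 1)\<close>. Rotating \<open>z\<close> in the
  self-map condition gives \<open>|M z| + |\<langle>z, C\<rangle>| \<le> |z|\<close>. Equality in \<open>|M u| \<le> |u|\<close> at an eigenvector
  \<open>u\<close> with unimodular eigenvalue forces \<open>C = 0\<close> and makes the orthogonal complement of \<open>u\<close> invariant
  under \<open>M\<close>. In dimension 2 the map is therefore \<open>M = diag(c, m)\<close> in an orthonormal basis, with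
  \<open>m \<noteq> 0\<close> by injectivity, and it embeds into \<open>diag(exp(t Ln c), exp(t Ln m))\<close>.\<close>

section \<open>The Hermitian form\<close>

lemma hermitian_add_left: "hermitian (x + y) w = hermitian x w + hermitian y w"
  by (simp add: hermitian_def sum.distrib algebra_simps)

lemma hermitian_diff_left: "hermitian (x - y) w = hermitian x w - hermitian y w"
  by (simp add: hermitian_def sum_subtractf algebra_simps)

lemma hermitian_scale_left: "hermitian (c *s x) w = c * hermitian x w"
  by (simp add: hermitian_def sum_distrib_left algebra_simps)

lemma hermitian_zero_left: "hermitian 0 w = 0"
  by (simp add: hermitian_def)

lemma cnj_hermitian: "cnj (hermitian z w) = hermitian w z"
  by (simp add: hermitian_def mult.commute)

lemma hermitian_add_right: "hermitian w (x + y) = hermitian w x + hermitian w y"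
  by (simp add: hermitian_def sum.distrib algebra_simps)

lemma hermitian_diff_right: "hermitian w (x - y) = hermitian w x - hermitian w y"
  by (simp add: hermitian_def sum_subtractf algebra_simps)

lemma hermitian_scale_right: "hermitian w (c *s x) = cnj c * hermitian w x"
  by (simp add: hermitian_def sum_distrib_left algebra_simps)

lemmas hermitian_simps = hermitian_add_left hermitian_diff_left hermitian_scale_left
  hermitian_zero_left hermitian_add_right hermitian_diff_right hermitian_scale_right

lemma hermitian_self: "hermitian z z = of_real ((norm z)\<^sup>2)"
  by (simp add: hermitian_def norm_vec_def L2_set_def sum_nonneg complex_mult_cnj cmod_power2)

lemma norm_smult: "norm (c *s z) = cmod c * norm z" for z :: "complex ^ 'n"
  by (simp add: norm_vec_def norm_mult L2_set_right_distrib)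

lemma Re_hermitian: "Re (hermitian z w) = z \<bullet> w"
  by (simp add: hermitian_def inner_vec_def inner_complex_def)

lemma unimodular_rotation:
  obtains c where "cmod c = 1" "c * w = of_real (cmod w)"
proof (cases "w = 0")
  case False
  show ?thesis
  proof (rule that[of "cnj w / of_real (cmod w)"])
    show "cmod (cnj w / of_real (cmod w)) = 1"
      using False by (simp add: norm_divide)
    have "cnj w * w = of_real (cmod w) * of_real (cmod w)"
      using complex_norm_square[of w] by (simp add: power2_eq_square mult.commute)
    then show "cnj w / of_real (cmod w) * w = of_real (cmod w)"
      using False by (simp add: field_simps)
  qed
qed (use that[of 1] in simp)

lemma scaleR_smult: "r *\<^sub>R x = complex_of_real r *s x"
  unfolding vec_eq_iff by (simp add: scaleR_conv_of_real[where 'a = complex])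

lemma norm_hermitian_le: "cmod (hermitian z w) \<le> norm z * norm w"
proof -
  obtain c where c: "cmod c = 1" "c * hermitian z w = of_real (cmod (hermitian z w))"
    by (rule unimodular_rotation)
  have "cmod (hermitian z w) = Re (hermitian (c *s z) w)"
    using c by (simp add: hermitian_scale_left)
  also have "\<dots> \<le> norm (c *s z) * norm w"
    unfolding Re_hermitian by (rule norm_cauchy_schwarz)
  finally show ?thesis
    using c by (simp add: norm_smult)
qed

lemma bounded_linear_hermitian: "bounded_linear (\<lambda>z. hermitian z w)"
proof (rule bounded_linear_intro[where K = "norm w"])
  fix r :: real and x
  show "hermitian (r *\<^sub>R x) w = r *\<^sub>R hermitian x w"
    by (simp add: scaleR_smult hermitian_scale_left scaleR_conv_of_real)
qed (simp_all add: hermitian_add_left norm_hermitian_le)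

lemma bounded_bilinear_smult: "bounded_bilinear ((*s) :: complex \<Rightarrow> complex ^ 'n \<Rightarrow> complex ^ 'n)"
proof
  show "\<exists>K. \<forall>a b. norm (a *s b :: complex ^ 'n) \<le> norm a * norm b * K"
    by (intro exI[of _ 1]) (simp add: norm_smult)
qed (simp_all add: scaleR_smult scaleR_conv_of_real mult.commute)

section \<open>Linear fractional maps\<close>

lemma linear_fractional_has_derivative:
  fixes A :: "complex ^ 'n ^ 'n"
  assumes q: "hermitian z C + d \<noteq> 0"
  obtains M where
    "((\<lambda>z. inverse (hermitian z C + d) *s (A *v z + B)) has_derivative (\<lambda>h. M *v h)) (at z)"
    "B = 0 \<Longrightarrow> z = 0 \<Longrightarrow> M = (\<chi> i j. inverse d * A $ i $ j)"
proof -
  let ?q = "inverse (hermitian z C + d)"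
  let ?D = "\<lambda>h. ?q *s (A *v h) + (- (?q * hermitian h C * ?q)) *s (A *v z + B)"
  define M where "M = matrix ?D"
  have 1: "((\<lambda>z. inverse (hermitian z C + d)) has_derivative (\<lambda>h. - (?q * hermitian h C * ?q))) (at z)"
    using bounded_linear.has_derivative[OF bounded_linear_hermitian, of "\<lambda>x. x"] q
    by (auto intro!: derivative_eq_intros)
  have 2: "((\<lambda>z. A *v z + B) has_derivative (\<lambda>h. A *v h)) (at z)"
    using bounded_linear.has_derivative[OF matrix_vector_mul_bounded_linear, of "\<lambda>x. x" _ _ A]
    by (auto intro!: derivative_eq_intros)
  have "((\<lambda>z. inverse (hermitian z C + d) *s (A *v z + B)) has_derivative ?D) (at z)"
    by (rule bounded_bilinear.FDERIV[OF bounded_bilinear_smult 1 2])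
  moreover have "Vector_Spaces.linear (*s) (*s) ?D"
    by unfold_locales (simp_all add: vec_eq_iff algebra_simps hermitian_simps
       matrix_vector_mult_def sum_distrib_left sum.distrib)
  then have "?D = (\<lambda>h. M *v h)"
    unfolding M_def by (simp add: matrix_works)
  ultimately have "((\<lambda>z. inverse (hermitian z C + d) *s (A *v z + B)) has_derivative (\<lambda>h. M *v h)) (at z)"
    by simp
  moreover have "M = (\<chi> i j. inverse d * A $ i $ j)" if "B = 0" "z = 0"
  proof -
    have "M = matrix (\<lambda>h. (\<chi> i j. inverse d * A $ i $ j) *v h)"
      unfolding M_def using that
      by (intro arg_cong[where f = matrix] ext)
        (simp add: hermitian_zero_left, simp add: vec_eq_iff matrix_vector_mult_def sum_distrib_left mult.assoc)
    then show ?thesis by simp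
  qed
  ultimately show thesis using that by blast
qed

lemma linear_fractional_holomorphic:
  fixes f :: "complex ^ 'n \<Rightarrow> complex ^ 'n"
  assumes "open D" "linear_fractional_on D f"
  shows "holomorphic_map_on D f"
  unfolding holomorphic_map_on_def
proof
  fix z assume z: "z \<in> D"
  obtain A B C d where f: "\<And>z. z \<in> D \<Longrightarrow> hermitian z C + d \<noteq> 0"
    "\<And>z. z \<in> D \<Longrightarrow> f z = inverse (hermitian z C + d) *s (A *v z + B)"
    using assms(2) unfolding linear_fractional_on_def by blast
  obtain M where
    "((\<lambda>z. inverse (hermitian z C + d) *s (A *v z + B)) has_derivative (\<lambda>h. M *v h)) (at z)"
    by (rule linear_fractional_has_derivative[OF f(1)[OF z]])
  then have "(f has_derivative (\<lambda>h. M *v h)) (at z)"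
    by (rule has_derivative_transform_within_open[OF _ \<open>open D\<close> z]) (simp add: f)
  then show "\<exists>M. (f has_derivative (\<lambda>h. M *v h)) (at z)" ..
qed

lemma hermitian_matrix_adjoint:
  "hermitian (A *v z) w = hermitian z ((\<chi> i j. cnj (A $ j $ i)) *v w)"
proof -
  have "hermitian (A *v z) w = (\<Sum>i\<in>UNIV. \<Sum>j\<in>UNIV. A $ i $ j * z $ j * cnj (w $ i))"
    by (simp add: hermitian_def matrix_vector_mult_def sum_distrib_right)
  also have "\<dots> = (\<Sum>j\<in>UNIV. \<Sum>i\<in>UNIV. A $ i $ j * z $ j * cnj (w $ i))"
    by (rule sum.swap)
  also have "\<dots> = hermitian z ((\<chi> i j. cnj (A $ j $ i)) *v w)"
    by (simp add: hermitian_def matrix_vector_mult_def sum_distrib_left ac_simps)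
  finally show ?thesis .
qed

lemma linear_fractional_compose:
  fixes f g :: "complex ^ 'n \<Rightarrow> complex ^ 'n"
  assumes "linear_fractional_on D f" "linear_fractional_on E g" "f ` D \<subseteq> E"
  shows "linear_fractional_on D (\<lambda>z. g (f z))"
proof -
  obtain A B C d where f: "\<And>z. z \<in> D \<Longrightarrow> hermitian z C + d \<noteq> 0"
    "\<And>z. z \<in> D \<Longrightarrow> f z = inverse (hermitian z C + d) *s (A *v z + B)"
    using assms(1) unfolding linear_fractional_on_def by blast
  obtain A' B' C' d' where g: "\<And>z. z \<in> E \<Longrightarrow> hermitian z C' + d' \<noteq> 0"
    "\<And>z. z \<in> E \<Longrightarrow> g z = inverse (hermitian z C' + d') *s (A' *v z + B')"
    using assms(2) unfolding linear_fractional_on_def by blast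
  define As where "As = (\<chi> i j. cnj (A $ j $ i))"
  define C2 where "C2 = As *v C' + cnj d' *s C"
  define d2 where "d2 = hermitian B C' + d' * d"
  define A2 where "A2 = A' ** A + (\<chi> i j. B' $ i * cnj (C $ j))"
  define B2 where "B2 = A' *v B + d *s B'"
  have "hermitian z C2 + d2 \<noteq> 0 \<and> g (f z) = inverse (hermitian z C2 + d2) *s (A2 *v z + B2)"
    if z: "z \<in> D" for z
  proof -
    define q where "q = hermitian z C + d"
    have q: "q \<noteq> 0" and fz: "f z = inverse q *s (A *v z + B)" and E: "f z \<in> E"
      using f[OF z] assms(3) z by (auto simp: q_def)
    have "q * (hermitian (f z) C' + d') = hermitian (A *v z + B) C' + d' * q"
      using q by (simp add: fz hermitian_simps field_simps)
    also have "\<dots> = hermitian z C2 + d2"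
      by (simp add: C2_def d2_def q_def As_def hermitian_simps hermitian_matrix_adjoint algebra_simps)
    finally have den: "hermitian z C2 + d2 = q * (hermitian (f z) C' + d')" ..
    have "(\<chi> i j. B' $ i * cnj (C $ j)) *v z = hermitian z C *s B'"
      by (simp add: vec_eq_iff matrix_vector_mult_def hermitian_def sum_distrib_left sum_distrib_right ac_simps)
    then have "A2 *v z + B2 = A' *v (A *v z + B) + q *s B'"
      by (simp add: A2_def B2_def q_def matrix_vector_mult_add_rdistrib
        matrix_vector_right_distrib flip: matrix_vector_mul_assoc)
    also have "A *v z + B = q *s f z"
      using q by (simp add: fz)
    also have "A' *v (q *s f z) + q *s B' = q *s (A' *v f z + B')"
      by (simp add: vec.scale)
    finally have "A2 *v z + B2 = q *s (A' *v f z + B')" .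
    moreover have "inverse (q * w) * q = inverse w" for w
      using q by simp
    ultimately show ?thesis
      using q g[OF E] unfolding den by (simp only: vector_smult_assoc) simp
  qed
  then show ?thesis
    unfolding linear_fractional_on_def by blast
qed

lemma LFM_iff:
  "f \<in> LFM \<longleftrightarrow> linear_fractional_on unit_ball f \<and> f ` unit_ball \<subseteq> unit_ball"
  using linear_fractional_holomorphic[OF open_ball, of 0 1 f]
  unfolding LFM_def holomorphic_self_map_def by blast

lemma LFM_compose:
  assumes "f \<in> LFM" "g \<in> LFM"
  shows "(\<lambda>z. g (f z)) \<in> LFM"
proof -
  have "linear_fractional_on unit_ball (\<lambda>z. g (f z))"
    using assms unfolding LFM_iff by (blast intro: linear_fractional_compose)
  then show ?thesis
    using assms unfolding LFM_iff by blast
qed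

lemma linear_in_LFM:
  fixes M :: "complex ^ 'n ^ 'n"
  assumes "\<And>z. norm (M *v z) \<le> norm z"
  shows "(*v) M \<in> LFM"
  unfolding LFM_iff
proof
  have "hermitian z 0 + 1 \<noteq> 0 \<and> M *v z = inverse (hermitian z 0 + 1) *s (M *v z + 0)" for z
    by (simp add: hermitian_def)
  then show "linear_fractional_on unit_ball ((*v) M)"
    unfolding linear_fractional_on_def by blast
  show "(*v) M ` unit_ball \<subseteq> unit_ball"
    using le_less_trans[OF assms] by (intro image_subsetI) simp
qed

section \<open>The involutive automorphisms of the ball\<close>

text \<open>The classical \<open>(a - P z - s Q z) / (1 - \<langle>z, a\<rangle>)\<close>, with \<open>P\<close> the projection onto the span of \<open>a\<close>
  and \<open>Q = 1 - P\<close>, rewritten by \<open>(1 - s) / |a|\<^sup>2 = 1 / (1 + s)\<close> to avoid dividing by \<open>|a|\<close>.\<close>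

definition ball_involution :: "complex ^ 'n \<Rightarrow> complex ^ 'n \<Rightarrow> complex ^ 'n"
  where "ball_involution a z =
    (let s = of_real (sqrt (1 - (norm a)\<^sup>2))
     in inverse (1 - hermitian z a) *s ((1 - hermitian z a / (1 + s)) *s a - s *s z))"

context
  fixes a :: "complex ^ 'n" and s :: complex
  assumes a: "norm a < 1" and s_def: "s = of_real (sqrt (1 - (norm a)\<^sup>2))"
begin

lemma norm_square_less_one: "(norm a)\<^sup>2 < 1"
  using a by (simp add: power_less_one_iff)

lemma involution_scale_square: "s * s = 1 - hermitian a a"
  using norm_square_less_one unfolding s_def hermitian_self of_real_mult[symmetric] by simp

lemma cnj_involution_scale: "cnj s = s"
  by (simp add: s_def)

lemma involution_scale_nonzero: "s \<noteq> 0"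
  using norm_square_less_one by (simp add: s_def)

lemma one_plus_involution_scale_nonzero: "1 + s \<noteq> 0"
proof -
  have "Re (1 + s) > 0"
    using norm_square_less_one by (simp add: s_def add_pos_nonneg)
  then show ?thesis by (metis less_irrefl zero_complex.sel(1))
qed

lemma hermitian_involution_point: "hermitian a a = (1 - s) * (1 + s)"
  using involution_scale_square by (simp add: algebra_simps)

lemma ball_involution_eq: "ball_involution a z =
    inverse (1 - hermitian z a) *s ((1 - hermitian z a / (1 + s)) *s a - s *s z)"
  by (simp add: ball_involution_def s_def Let_def)

lemma involution_denominator_nonzero:
  assumes "norm z < 1"
  shows "1 - hermitian z a \<noteq> 0"
proof
  assume "1 - hermitian z a = 0"
  then have "1 \<le> norm z * norm a"
    using norm_hermitian_le[of z a] by simp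
  moreover have "norm z * norm a < 1 * 1"
    using a assms by (intro mult_strict_mono') auto
  ultimately show False by simp
qed

lemma hermitian_ball_involution:
  assumes "norm z < 1"
  shows "1 - hermitian (ball_involution a z) a = s\<^sup>2 / (1 - hermitian z a)"
proof -
  define k where "k = hermitian z a"
  have k: "1 - k \<noteq> 0"
    using involution_denominator_nonzero[OF assms] by (simp add: k_def)
  have "hermitian (ball_involution a z) a =
      inverse (1 - k) * ((1 - k / (1 + s)) * ((1 - s) * (1 + s)) - s * k)"
    by (simp only: ball_involution_eq hermitian_simps hermitian_involution_point flip: k_def)
  also have "(1 - k / (1 + s)) * ((1 - s) * (1 + s)) - s * k = (1 - k) - s\<^sup>2"
    using one_plus_involution_scale_nonzero by (simp add: field_simps power2_eq_square)
  also have "inverse (1 - k) * ((1 - k) - s\<^sup>2) = 1 - s\<^sup>2 / (1 - k)"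
    using k by (simp add: field_simps)
  finally show ?thesis
    by (simp add: k_def)
qed

lemma ball_involution_involutive:
  assumes "norm z < 1"
  shows "ball_involution a (ball_involution a z) = z"
proof -
  define k where "k = hermitian z a"
  have k: "1 - k \<noteq> 0"
    using involution_denominator_nonzero[OF assms] by (simp add: k_def)
  have h: "hermitian (ball_involution a z) a = 1 - s\<^sup>2 / (1 - k)"
    using hermitian_ball_involution[OF assms] by (simp add: k_def algebra_simps)
  have *: "1 - (1 - s\<^sup>2 / p) / t = s * (1 - (1 - p) / t) / p"
    if "p \<noteq> 0" "t \<noteq> 0" "s = t - 1" for p t
    using that(1,2) unfolding that(3) by (simp add: field_simps power2_eq_square)
  have c: "1 - (1 - s\<^sup>2 / (1 - k)) / (1 + s) = s * (1 - k / (1 + s)) / (1 - k)"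
    using *[OF k one_plus_involution_scale_nonzero] by simp
  have "ball_involution a (ball_involution a z) = ((1 - k) / s\<^sup>2) *s
      ((s * (1 - k / (1 + s)) / (1 - k)) *s a - s *s ball_involution a z)"
    by (subst ball_involution_eq) (simp only: h c, simp)
  also have "\<dots> = z"
  proof -
    have e: "ball_involution a z = inverse (1 - k) *s ((1 - k / (1 + s)) *s a - s *s z)"
      by (simp only: ball_involution_eq k_def)
    have *: "(p / s\<^sup>2) * ((s * c / p) * x - s * (inverse p * (c * x - s * y))) = y"
      if "p \<noteq> 0" for p c x y
      using that involution_scale_nonzero by (simp add: field_simps power2_eq_square)
    show ?thesis
      unfolding e vec_eq_iff vector_smult_component vector_minus_component
      using *[OF k] by blast
  qed
  finally show ?thesis .
qed

lemma norm_ball_involution: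
  assumes z: "norm z < 1"
  shows "norm (ball_involution a z) < 1"
proof -
  define k where "k = hermitian z a"
  define r where "r = 1 / (1 + s)"
  define v where "v = (1 - k * r) *s a - s *s z"
  have k: "1 - k \<noteq> 0" and r: "r * (1 + s) = 1" and cr: "cnj r = r"
    using involution_denominator_nonzero[OF z] one_plus_involution_scale_nonzero
    by (simp_all add: k_def r_def cnj_involution_scale)
  have h: "hermitian z a = k" "hermitian a z = cnj k"
    by (simp_all add: k_def cnj_hermitian)
  have alg: "(1 - x * r) * (1 - y * r) * ((1 - s) * (1 + s))
      - s * (1 - x * r) * y - s * (1 - y * r) * x + s * s * w = (1 - x) * (1 - y) - s * s * (1 - w)"
    if "r * (1 + s) = 1" for x y w r s :: complex
    using that by algebra
  have "hermitian v v = (1 - k * r) * (1 - cnj k * r) * ((1 - s) * (1 + s))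
      - s * (1 - k * r) * cnj k - s * (1 - cnj k * r) * k + s * s * hermitian z z"
    by (simp add: v_def hermitian_simps hermitian_involution_point h cnj_involution_scale cr algebra_simps)
  also have "\<dots> = (1 - k) * cnj (1 - k) - s * s * (1 - hermitian z z)"
    by (simp add: alg[OF r])
  finally have "complex_of_real ((norm v)\<^sup>2) =
      of_real ((cmod (1 - k))\<^sup>2 - (1 - (norm a)\<^sup>2) * (1 - (norm z)\<^sup>2))"
    unfolding involution_scale_square hermitian_self complex_norm_square[symmetric] by simp
  then have "(norm v)\<^sup>2 = (cmod (1 - k))\<^sup>2 - (1 - (norm a)\<^sup>2) * (1 - (norm z)\<^sup>2)"
    by (simp only: of_real_eq_iff)
  moreover have "(1 - (norm a)\<^sup>2) * (1 - (norm z)\<^sup>2) > 0"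
    using norm_square_less_one z by (simp add: power_less_one_iff)
  ultimately have "norm v < cmod (1 - k)"
    by (intro power2_less_imp_less[of "norm v"]) auto
  moreover have "ball_involution a z = inverse (1 - k) *s v"
    by (simp add: ball_involution_eq v_def k_def r_def)
  ultimately show ?thesis
    using k by (simp add: norm_smult norm_divide inverse_eq_divide del: right_minus_eq)
qed

lemma ball_involution_zero: "ball_involution a 0 = a"
  by (simp add: ball_involution_eq hermitian_zero_left)

lemma ball_involution_self: "ball_involution a a = 0"
proof -
  have "(1 - hermitian a a / (1 + s)) = s"
    using one_plus_involution_scale_nonzero by (simp add: hermitian_involution_point)
  then show ?thesis by (simp add: ball_involution_eq)
qed

lemma ball_involution_LFM: "ball_involution a \<in> LFM"
  unfolding LFM_iff
proof
  define A where "A = (\<chi> i j. - (if i = j then s else 0) - a $ i * cnj (a $ j) / (1 + s))"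
  have A: "A *v z = - (hermitian z a / (1 + s)) *s a - s *s z" for z
  proof -
    have "(A *v z) $ i = (\<Sum>j\<in>UNIV. (if i = j then - s * z $ j else 0)
        - a $ i / (1 + s) * (z $ j * cnj (a $ j)))" for i
      unfolding A_def matrix_vector_mult_def
      by (auto intro!: sum.cong simp: algebra_simps)
    then show ?thesis
      by (simp only: vec_eq_iff sum_subtractf hermitian_def flip: sum_distrib_left) simp
  qed
  have "hermitian z (- a) = - hermitian z a" for z
    by (simp add: hermitian_def sum_negf)
  then have "hermitian z (- a) + 1 \<noteq> 0 \<and>
      ball_involution a z = inverse (hermitian z (- a) + 1) *s (A *v z + a)" if "norm z < 1" for z
    using involution_denominator_nonzero[OF that]
    by (simp add: ball_involution_eq A vec_eq_iff algebra_simps)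
  then show "linear_fractional_on unit_ball (ball_involution a)"
    unfolding linear_fractional_on_def by (metis mem_ball_0)
  show "ball_involution a ` unit_ball \<subseteq> unit_ball"
    using norm_ball_involution by auto
qed

end

section \<open>The compact-open topology\<close>

lemma continuous_map_compact_open:
  fixes \<Phi> :: "'a::topological_space \<Rightarrow> 'c::topological_space \<Rightarrow> 'b::topological_space"
  assumes "continuous_on (T \<times> D) (\<lambda>(t, z). \<Phi> t z)"
  shows "continuous_map (top_of_set T) (compact_open D) \<Phi>"
  unfolding compact_open_def
proof (rule continuous_on_generated_topo)
  fix U assume "U \<in> {{f. f ` K \<subseteq> U} | K U. compact K \<and> K \<subseteq> D \<and> open (U :: 'b set)}"
  then obtain K V where U: "U = {f. f ` K \<subseteq> V}" "compact K" "K \<subseteq> D" "open V" by blast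
  have "continuous_on (T \<times> K) (\<lambda>(t, z). \<Phi> t z)"
    using assms U by (auto intro: continuous_on_subset)
  then have W: "openin (top_of_set (T \<times> K)) ((T \<times> K) \<inter> (\<lambda>(t, z). \<Phi> t z) -` V)"
    using U(4) by (rule continuous_openin_preimage_gen)
  have "openin (top_of_set T) (\<Phi> -` U \<inter> T)"
  proof (subst openin_subopen, intro ballI)
    fix t assume t: "t \<in> \<Phi> -` U \<inter> T"
    have tK: "{t} \<times> K \<subseteq> (T \<times> K) \<inter> (\<lambda>(t, z). \<Phi> t z) -` V"
      using t U by auto
    have c: "compactin (top_of_set K) K" "t \<in> topspace (top_of_set T)"
      using t U by (simp_all add: compactin_subtopology)
    obtain X Y where XY: "openin (top_of_set T) X" "t \<in> X" "K \<subseteq> Y"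
      "X \<times> Y \<subseteq> (T \<times> K) \<inter> (\<lambda>(t, z). \<Phi> t z) -` V"
      using tube_lemma_right[OF W[folded prod_topology_subtopology_eu] c tK] by (elim exE conjE)
    have "X \<subseteq> \<Phi> -` U \<inter> T"
    proof
      fix x assume x: "x \<in> X"
      have "\<Phi> x z \<in> V" if "z \<in> K" for z
      proof -
        have "(x, z) \<in> X \<times> Y"
          using x that XY(3) by blast
        then show ?thesis using XY(4) by auto
      qed
      then show "x \<in> \<Phi> -` U \<inter> T"
        using x openin_imp_subset[OF XY(1)] by (auto simp: U(1))
    qed
    then show "\<exists>S. openin (top_of_set T) S \<and> t \<in> S \<and> S \<subseteq> \<Phi> -` U \<inter> T"
      using XY by blast
  qed
  then show "openin (top_of_set T) (\<Phi> -` U \<inter> topspace (top_of_set T))" by simp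
next
  have "UNIV \<in> {{f. f ` K \<subseteq> U} | K U. compact K \<and> K \<subseteq> D \<and> open (U :: 'b set)}"
    by (intro CollectI exI[of _ "{}"] exI[of _ UNIV]) auto
  then show "\<Phi> ` topspace (top_of_set T) \<subseteq> \<Union>{{f. f ` K \<subseteq> U} | K U. compact K \<and> K \<subseteq> D \<and> open U}"
    by (rule subset_trans[OF subset_UNIV Union_upper])
qed

section \<open>The spectral radius in dimension 2\<close>

lemma spectrum_2_finite_nonempty:
  fixes M :: "complex ^ 2 ^ 2"
  shows "finite (spectrum M)" "spectrum M \<noteq> {}"
proof -
  define p where "p = [:M $ 1 $ 1 * M $ 2 $ 2 - M $ 1 $ 2 * M $ 2 $ 1, - (M $ 1 $ 1 + M $ 2 $ 2), 1:]"
  have spec: "c \<in> spectrum M \<longleftrightarrow> poly p c = 0" for c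
  proof -
    have "(M - mat c) *v v = M *v v - c *s v" for v
      by (simp add: vec_eq_iff forall_2 matrix_vector_mult_def sum_2 mat_def algebra_simps)
    then have "c \<in> spectrum M \<longleftrightarrow> \<not> (\<forall>v. (M - mat c) *v v = 0 \<longrightarrow> v = 0)"
      by (auto simp: spectrum_def)
    also have "\<dots> \<longleftrightarrow> det (M - mat c) = 0"
      by (metis matrix_left_invertible_ker invertible_left_inverse invertible_det_nz)
    also have "det (M - mat c) = poly p c"
      by (simp add: det_2 mat_def p_def algebra_simps)
    finally show ?thesis .
  qed
  have "spectrum M = {c. poly p c = 0}"
    using spec by blast
  moreover have "p \<noteq> 0"
    by (simp add: p_def)
  ultimately show "finite (spectrum M)"
    using poly_roots_finite[of p] by simp
  have "\<not> constant (poly p)"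
    by (simp add: constant_degree p_def)
  then show "spectrum M \<noteq> {}"
    using fundamental_theorem_of_algebra[of p] spec by blast
qed

lemma spectral_radius_attained:
  fixes M :: "complex ^ 2 ^ 2"
  obtains c v where "cmod c = spectral_radius M" "v \<noteq> 0" "M *v v = c *s v"
proof -
  have "spectral_radius M \<in> cmod ` spectrum M"
    unfolding spectral_radius_def using spectrum_2_finite_nonempty[of M] by (intro Max_in) auto
  then show ?thesis
    using that by (auto simp: spectrum_def)
qed

section \<open>Linear fractional maps fixing the origin\<close>

text \<open>Rotating \<open>z\<close> makes \<open>\<langle>z, C\<rangle>\<close> negative, which is where the self-map condition
  \<open>|M z| < |\<langle>z, C\<rangle> + 1|\<close> is strongest.\<close>

lemma linear_fractional_contraction:
  fixes M :: "complex ^ 'n ^ 'n"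
  assumes den: "\<And>z. norm z < 1 \<Longrightarrow> hermitian z C + 1 \<noteq> 0"
    and self: "\<And>z. norm z < 1 \<Longrightarrow> norm (inverse (hermitian z C + 1) *s (M *v z)) < 1"
  shows "norm (M *v z) + cmod (hermitian z C) \<le> norm z"
proof -
  have ball: "norm (M *v z) + cmod (hermitian z C) \<le> 1" if z: "norm z < 1" for z
  proof -
    let ?k = "hermitian z C"
    have k: "cmod ?k < 1"
    proof (rule ccontr)
      assume "\<not> cmod ?k < 1"
      then have k: "cmod ?k \<ge> 1" by simp
      have "norm ((- inverse ?k) *s z) \<le> norm z"
        using k by (simp add: norm_smult norm_inverse mult_left_le_one_le inverse_le_1_iff)
      moreover have "hermitian ((- inverse ?k) *s z) C + 1 = 0"
        using k by (simp only: hermitian_scale_left) (cases "?k = 0"; simp)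
      ultimately show False
        using den[of "(- inverse ?k) *s z"] z by simp
    qed
    obtain c where c: "cmod c = 1" "c * ?k = of_real (cmod ?k)"
      by (rule unimodular_rotation)
    let ?z = "(- c) *s z"
    have h: "hermitian ?z C + 1 = of_real (1 - cmod ?k)"
      using c by (simp only: hermitian_scale_left) simp
    have "cmod (of_real (1 - cmod ?k)) = 1 - cmod ?k"
      using k by (simp only: norm_of_real)
    then have "norm (M *v ?z) / (1 - cmod ?k) < 1"
      using self[of ?z] z c by (simp only: h norm_smult norm_inverse) (simp add: norm_smult divide_inverse mult.commute)
    moreover have "norm (M *v ?z) = norm (M *v z)"
      using c by (simp only: vec.scale norm_smult) simp
    ultimately show ?thesis
      using k by (simp add: field_simps)
  qed
  show ?thesis
  proof (rule dense_ge)
    fix r assume r: "norm z < r"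
    then have "r > 0" by (rule le_less_trans[OF norm_ge_zero])
    have "norm (of_real (inverse r) *s z) < 1"
      using r \<open>r > 0\<close> by (simp add: norm_smult norm_divide field_simps)
    from ball[OF this] show "norm (M *v z) + cmod (hermitian z C) \<le> r"
      using \<open>r > 0\<close> by (simp only: vec.scale norm_smult hermitian_scale_left norm_mult norm_of_real)
        (simp add: field_simps)
  qed
qed

text \<open>At \<open>u + t w\<close> the left-hand side of the hypothesis exceeds 1 by a term linear in \<open>|t|\<close>, the
  right-hand side only by a quadratic one.\<close>

lemma contraction_eigenvector_complement:
  fixes M :: "complex ^ 'n ^ 'n"
  assumes contr: "\<And>z. norm (M *v z) + cmod (hermitian z C) \<le> norm z"
    and u: "norm u = 1" "M *v u = c *s u" "cmod c = 1"
    and w: "hermitian w u = 0"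
  shows "hermitian (M *v w) u = 0" "hermitian w C = 0"
proof -
  have uC: "hermitian u C = 0"
    using contr[of u] u by (simp add: norm_smult)
  let ?m = "hermitian (M *v w) u" and ?h = "hermitian w C"
  obtain b where b: "cmod b = 1" "b * ?m = of_real (cmod ?m)"
    by (rule unimodular_rotation)
  have bound: "cmod ?m + cmod ?h \<le> e * (norm w)\<^sup>2" if e: "e > 0" for e :: real
  proof -
    define t where "t = of_real e * c * b"
    have t: "cmod t = e"
      using e u b by (simp add: t_def norm_mult)
    let ?z = "u + t *s w"
    have "hermitian u w = 0"
      using w cnj_hermitian[of w u] by simp
    then have "hermitian ?z ?z = hermitian u u + t * cnj t * hermitian w w"
      using w by (simp add: hermitian_simps)
    then have "hermitian ?z ?z = of_real (1 + (cmod t)\<^sup>2 * (norm w)\<^sup>2)"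
      using u by (simp add: hermitian_self complex_norm_square[symmetric] flip: of_real_power)
    then have nz: "(norm ?z)\<^sup>2 = 1 + (e * norm w)\<^sup>2"
      by (simp only: hermitian_self of_real_eq_iff t power_mult_distrib)
    have "(norm ?z)\<^sup>2 \<le> (1 + e\<^sup>2 * (norm w)\<^sup>2)\<^sup>2"
      unfolding nz by (simp add: power2_sum power_mult_distrib)
    then have z: "norm ?z \<le> 1 + e\<^sup>2 * (norm w)\<^sup>2"
      by (rule power2_le_imp_le) simp
    have "hermitian (M *v ?z) u = c + of_real e * c * (b * ?m)"
      using u by (simp add: vec.add vec.scale hermitian_simps hermitian_self t_def)
    also have "\<dots> = c * of_real (1 + e * cmod ?m)"
      unfolding b by (simp add: algebra_simps)
    finally have "cmod (hermitian (M *v ?z) u) = 1 + e * cmod ?m"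
      using u e by (simp only: norm_mult norm_of_real) simp
    then have "1 + e * cmod ?m \<le> norm (M *v ?z)"
      using norm_hermitian_le[of "M *v ?z" u] u by simp
    moreover have "cmod (hermitian ?z C) = e * cmod ?h"
      by (simp add: hermitian_simps uC norm_mult t)
    ultimately have "e * (cmod ?m + cmod ?h) \<le> e * (e * (norm w)\<^sup>2)"
      using contr[of ?z] z by (simp add: algebra_simps power2_eq_square)
    then show ?thesis
      using e by simp
  qed
  have "((\<lambda>e. e * (norm w)\<^sup>2) \<longlongrightarrow> 0 * (norm w)\<^sup>2) (at_right 0)"
    by (intro tendsto_intros)
  then have "cmod ?m + cmod ?h \<le> 0 * (norm w)\<^sup>2"
    by (rule tendsto_lowerbound) (auto intro: bound eventually_mono[OF eventually_at_right_less])
  then have "cmod ?m \<le> 0" "cmod ?h \<le> 0"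
    using norm_ge_zero[of ?m] norm_ge_zero[of ?h] by linarith+
  then show "?m = 0" "?h = 0" by simp_all
qed

lemma LFM_fix_zero:
  fixes f :: "complex ^ 'n \<Rightarrow> complex ^ 'n"
  assumes "f \<in> LFM" "f 0 = 0"
  obtains M C where "(f has_derivative (*v) M) (at 0)"
    "\<And>z. norm z < 1 \<Longrightarrow> hermitian z C + 1 \<noteq> 0"
    "\<And>z. norm z < 1 \<Longrightarrow> f z = inverse (hermitian z C + 1) *s (M *v z)"
proof -
  obtain A B C d where f: "\<And>z. norm z < 1 \<Longrightarrow> hermitian z C + d \<noteq> 0"
    "\<And>z. norm z < 1 \<Longrightarrow> f z = inverse (hermitian z C + d) *s (A *v z + B)"
  proof -
    obtain A B C d where "\<forall>z\<in>unit_ball. hermitian z C + d \<noteq> 0 \<and>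
        f z = inverse (hermitian z C + d) *s (A *v z + B)"
      using assms(1) unfolding LFM_iff linear_fractional_on_def by blast
    then show thesis
      using that[of C d A B] unfolding Ball_def mem_ball_0 by blast
  qed
  have d: "d \<noteq> 0"
    using f(1)[of 0] by (simp add: hermitian_zero_left)
  have B: "B = 0"
    using f(2)[of 0] assms(2) d by (simp add: hermitian_zero_left)
  define M where "M = (\<chi> i j. inverse d * A $ i $ j)"
  define C' where "C' = cnj (inverse d) *s C"
  have M: "M *v z = inverse d *s (A *v z)" for z
    by (simp add: M_def vec_eq_iff matrix_vector_mult_def sum_distrib_left mult.assoc)
  have C': "hermitian z C' + 1 = inverse d * (hermitian z C + d)" for z
    using d by (simp add: C'_def hermitian_scale_right algebra_simps)
  show thesis
  proof (rule that)
    obtain M' where M': "((\<lambda>z. inverse (hermitian z C + d) *s (A *v z + B)) has_derivative (\<lambda>h. M' *v h)) (at 0)"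
      "M' = M"
      using linear_fractional_has_derivative[of 0 C d A B] f(1)[of 0] B unfolding M_def by auto
    show "(f has_derivative (*v) M) (at 0)"
      by (rule has_derivative_transform_within_open[OF M'(1)[unfolded M'(2)] open_ball[of 0 1]]) (simp_all add: f)
    show "hermitian z C' + 1 \<noteq> 0" if "norm z < 1" for z
      using f(1)[OF that] d by (simp add: C')
    show "f z = inverse (hermitian z C' + 1) *s (M *v z)" if "norm z < 1" for z
    proof -
      have "inverse (inverse d * q) * inverse d = inverse q" for q
        using d by simp
      then show ?thesis
        unfolding f(2)[OF that] C' M vector_smult_assoc B by simp
    qed
  qed
qed

lemma LFM_rigid_at_zero:
  fixes f :: "complex ^ 'n \<Rightarrow> complex ^ 'n"
  assumes f: "f \<in> LFM" "f 0 = 0" and M: "(f has_derivative (*v) M) (at 0)"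
    and v: "v \<noteq> 0" "M *v v = c *s v" "cmod c = 1"
  shows "\<And>z. norm (M *v z) \<le> norm z" "\<And>z. norm z < 1 \<Longrightarrow> f z = M *v z"
    "\<And>u w. M *v u = c *s u \<Longrightarrow> norm u = 1 \<Longrightarrow> hermitian w u = 0 \<Longrightarrow> hermitian (M *v w) u = 0"
proof -
  obtain M' C where M': "(f has_derivative (*v) M') (at 0)"
    and den: "\<And>z. norm z < 1 \<Longrightarrow> hermitian z C + 1 \<noteq> 0"
    and fz: "\<And>z. norm z < 1 \<Longrightarrow> f z = inverse (hermitian z C + 1) *s (M' *v z)"
    using LFM_fix_zero[OF f] by metis
  have "(*v) M' = (*v) M"
    by (rule has_derivative_unique[OF M' M])
  then have fz: "f z = inverse (hermitian z C + 1) *s (M *v z)" if "norm z < 1" for z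
    using fz[OF that] by metis
  have contr: "norm (M *v z) + cmod (hermitian z C) \<le> norm z" for z
  proof (rule linear_fractional_contraction[OF den])
    fix z :: "complex ^ 'n" assume z: "norm z < 1"
    then have "f z \<in> unit_ball"
      using f(1) unfolding LFM_iff mem_ball_0[symmetric] by blast
    then show "norm (inverse (hermitian z C + 1) *s (M *v z)) < 1"
      using fz[OF z] by simp
  qed
  then show "norm (M *v z) \<le> norm z" for z
    using norm_ge_zero[of "hermitian z C"] by (meson add_le_cancel_left le_add_same_cancel1 order_trans)
  note compl = contraction_eigenvector_complement[OF contr _ _ v(3)]
  show "hermitian (M *v w) u = 0" if "M *v u = c *s u" "norm u = 1" "hermitian w u = 0" for u w
    by (rule compl(1)[OF that(2,1,3)])
  define u where "u = of_real (inverse (norm v)) *s v"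
  have u: "norm u = 1" "M *v u = c *s u"
    using v by (simp_all add: u_def norm_smult norm_inverse vec.scale mult.commute)
  have uC: "hermitian u C = 0"
    using contr[of u] u v by (simp add: norm_smult)
  have "hermitian z C = 0" for z
  proof -
    have "hermitian (z - hermitian z u *s u) u = 0"
      using u by (simp add: hermitian_diff_left hermitian_scale_left hermitian_self)
    from compl(2)[OF u this] show ?thesis
      by (simp add: hermitian_diff_left hermitian_scale_left uC)
  qed
  then show "f z = M *v z" if "norm z < 1" for z
    using fz[OF that] by simp
qed

section \<open>Diagonal semigroups and their conjugates\<close>

lemma orthonormal_completion_2:
  fixes u :: "complex ^ 2"
  assumes "norm u = 1"
  obtains w where "norm w = 1" "hermitian w u = 0"
    "\<And>z. z = hermitian z u *s u + hermitian z w *s w"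
proof -
  define w :: "complex ^ 2" where "w = (\<chi> i. if i = 1 then - cnj (u $ 2) else cnj (u $ 1))"
  have u: "u $ 1 * cnj (u $ 1) + u $ 2 * cnj (u $ 2) = 1"
    using hermitian_self[of u] assms by (simp add: hermitian_def sum_2)
  have "hermitian w w = 1"
    using u by (simp add: hermitian_def sum_2 w_def mult.commute add.commute)
  then have "norm w = 1"
    unfolding hermitian_self of_real_eq_1_iff by (simp add: abs_square_eq_1)
  moreover have "hermitian w u = 0"
    by (simp add: hermitian_def sum_2 w_def mult.commute)
  moreover have "z = hermitian z u *s u + hermitian z w *s w" for z
  proof -
    have "z $ 1 = (z $ 1 * cnj (u $ 1) + z $ 2 * cnj (u $ 2)) * u $ 1
      + (z $ 1 * (- (u $ 2)) + z $ 2 * u $ 1) * (- cnj (u $ 2))"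
      "z $ 2 = (z $ 1 * cnj (u $ 1) + z $ 2 * cnj (u $ 2)) * u $ 2
      + (z $ 1 * (- (u $ 2)) + z $ 2 * u $ 1) * cnj (u $ 1)"
      using u by algebra+
    then show ?thesis
      by (simp add: vec_eq_iff forall_2 hermitian_def sum_2 w_def algebra_simps)
  qed
  ultimately show ?thesis using that by blast
qed

lemma norm_orthonormal_combination:
  assumes "norm u = 1" "norm w = 1" "hermitian w u = 0"
  shows "(norm (x *s u + y *s w))\<^sup>2 = (cmod x)\<^sup>2 + (cmod y)\<^sup>2"
proof -
  have "hermitian u w = 0"
    using assms(3) cnj_hermitian[of w u] by simp
  then have "hermitian (x *s u + y *s w) (x *s u + y *s w) =
      x * cnj x * hermitian u u + y * cnj y * hermitian w w"
    using assms(3) by (simp add: hermitian_simps)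
  also have "\<dots> = of_real ((cmod x)\<^sup>2 + (cmod y)\<^sup>2)"
    using assms(1,2) by (simp add: hermitian_self complex_norm_square[symmetric])
  finally show ?thesis
    by (simp only: hermitian_self of_real_eq_iff)
qed

lemma diagonal_contraction_semigroup:
  fixes M :: "complex ^ 2 ^ 2"
  assumes uw: "norm u = 1" "norm w = 1" "hermitian w u = 0"
    "\<And>z. z = hermitian z u *s u + hermitian z w *s w"
    and M: "M *v u = c *s u" "M *v w = m *s w"
    and c: "0 < cmod c" "cmod c \<le> 1" and m: "0 < cmod m" "cmod m \<le> 1"
  obtains L :: "real \<Rightarrow> complex ^ 2 ^ 2" where
    "\<And>z. L 0 *v z = z" "\<And>s t z. L (t + s) *v z = L t *v (L s *v z)" "L 1 = M"
    "\<And>t z. 0 \<le> t \<Longrightarrow> norm (L t *v z) \<le> norm z"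
    "continuous_on UNIV (\<lambda>(t, z). L t *v z)"
proof -
  define e where "e b t = exp (of_real t * Ln b)" for b and t :: real
  have e: "e b 0 = 1" "e b (t + s) = e b t * e b s" for b s t
    by (simp_all add: e_def distrib_right exp_add)
  have e1: "e b 1 = b" if "0 < cmod b" for b
    using that by (auto simp: e_def)
  have e_le: "cmod (e b t) \<le> 1" if "0 < cmod b" "cmod b \<le> 1" "0 \<le> t" for b t
  proof -
    have "b \<noteq> 0" using that by auto
    then show ?thesis
      using that by (simp add: e_def mult_nonneg_nonpos)
  qed
  define L where "L t = (\<chi> i j. e c t * (u $ i * cnj (u $ j)) + e m t * (w $ i * cnj (w $ j)))" for t
  have L: "L t *v z = (e c t * hermitian z u) *s u + (e m t * hermitian z w) *s w" for t z
    by (simp add: vec_eq_iff forall_2 L_def matrix_vector_mult_def hermitian_def sum_2 algebra_simps)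
  have wu: "hermitian u w = 0"
    using uw(3) cnj_hermitian[of w u] by simp
  show thesis
  proof (rule that[of L])
    show "L 0 *v z = z" for z
      using uw(4)[of z] by (simp add: L e)
    show "L (t + s) *v z = L t *v (L s *v z)" for s t z
    proof -
      have "hermitian (L s *v z) u = e c s * hermitian z u"
        "hermitian (L s *v z) w = e m s * hermitian z w"
        using uw wu unfolding L by (simp_all add: hermitian_simps hermitian_self)
      then show ?thesis
        by (simp only: L[of t] L[of "t + s"] e(2) mult.assoc)
    qed
    have "L 1 *v z = M *v z" for z
    proof -
      have "M *v z = M *v (hermitian z u *s u + hermitian z w *s w)"
        using uw(4) by metis
      also have "\<dots> = L 1 *v z"
        using c m by (simp add: L e1 vec.add vec.scale M mult.commute)
      finally show ?thesis ..
    qed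
    then show "L 1 = M"
      by (simp add: matrix_eq)
    show "norm (L t *v z) \<le> norm z" if t: "0 \<le> t" for t z
    proof (rule power2_le_imp_le)
      have "(norm (L t *v z))\<^sup>2 = (cmod (e c t) * cmod (hermitian z u))\<^sup>2 + (cmod (e m t) * cmod (hermitian z w))\<^sup>2"
        using norm_orthonormal_combination[OF uw(1-3)] by (simp add: L norm_mult)
      also have "\<dots> \<le> (cmod (hermitian z u))\<^sup>2 + (cmod (hermitian z w))\<^sup>2"
        using e_le[OF c t] e_le[OF m t]
        by (intro add_mono power_mono mult_left_le_one_le) auto
      also have "\<dots> = (norm z)\<^sup>2"
        using norm_orthonormal_combination[OF uw(1-3), of "hermitian z u" "hermitian z w"] uw(4)[of z] by simp
      finally show "(norm (L t *v z))\<^sup>2 \<le> (norm z)\<^sup>2" .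
    qed simp
    have h: "continuous_on UNIV (\<lambda>p :: real \<times> (complex ^ 2). hermitian (snd p) x)" for x
      by (intro bounded_linear.continuous_on[OF bounded_linear_hermitian] continuous_intros)
    have e': "continuous_on UNIV (\<lambda>p :: real \<times> (complex ^ 2). e b (fst p))" for b
      unfolding e_def by (intro continuous_intros)
    show "continuous_on UNIV (\<lambda>(t, z). L t *v z)"
      unfolding L case_prod_beta
      by (intro continuous_on_add bounded_bilinear.continuous_on[OF bounded_bilinear_smult]
        continuous_on_mult h e' continuous_on_const)
  qed
qed

lemma LFM_has_derivative:
  fixes f :: "complex ^ 'n \<Rightarrow> complex ^ 'n"
  assumes "f \<in> LFM" "norm z < 1"
  obtains M where "(f has_derivative (*v) M) (at z)"
  using assms unfolding LFM_def holomorphic_self_map_def holomorphic_map_on_def mem_ball_0[symmetric]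
  by blast

lemma LFM_continuous_on:
  fixes f :: "complex ^ 'n \<Rightarrow> complex ^ 'n"
  assumes "f \<in> LFM"
  shows "continuous_on unit_ball f"
proof (rule continuous_at_imp_continuous_on, rule ballI)
  fix z :: "complex ^ 'n" assume "z \<in> unit_ball"
  then obtain M where "(f has_derivative (*v) M) (at z)"
    using LFM_has_derivative[OF assms] by auto
  then show "isCont f z" by (rule has_derivative_continuous)
qed

lemma LFM_norm_less:
  assumes "f \<in> LFM" "norm z < 1"
  shows "norm (f z) < 1"
  using assms unfolding LFM_iff mem_ball_0[symmetric] by blast

lemma jacobian_eq:
  fixes f :: "complex ^ 'n \<Rightarrow> complex ^ 'm"
  assumes "(f has_derivative (*v) M) (at z)"
  shows "jacobian f (at z) = M"
  unfolding jacobian_def frechet_derivative_at[OF assms, symmetric] by simp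

lemma involution_conjugate_eigenvector:
  fixes f \<sigma> :: "complex ^ 'n \<Rightarrow> complex ^ 'n"
  assumes \<sigma>: "\<sigma> \<in> LFM" "\<And>z. norm z < 1 \<Longrightarrow> \<sigma> (\<sigma> z) = z" "\<sigma> 0 = a" "\<sigma> a = 0"
    and a: "norm a < 1" "f a = a" and J: "(f has_derivative (*v) J) (at a)"
    and v: "v \<noteq> 0" "J *v v = c *s v"
  obtains M u where "((\<lambda>z. \<sigma> (f (\<sigma> z))) has_derivative (*v) M) (at 0)" "u \<noteq> 0" "M *v u = c *s u"
proof -
  obtain P where P: "(\<sigma> has_derivative (*v) P) (at 0)"
    using LFM_has_derivative[OF \<sigma>(1), of 0] by auto
  obtain Q where Q: "(\<sigma> has_derivative (*v) Q) (at a)"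
    using LFM_has_derivative[OF \<sigma>(1) a(1)] by auto
  have "((\<lambda>z. \<sigma> (\<sigma> z)) has_derivative (\<lambda>h. P *v (Q *v h))) (at a)"
    using has_derivative_compose[OF Q, of \<sigma>] P \<sigma>(4) by simp
  moreover have "((\<lambda>z. \<sigma> (\<sigma> z)) has_derivative (\<lambda>h. h)) (at a)"
    by (rule has_derivative_transform_within_open[OF has_derivative_ident open_ball[of 0 1]])
      (use a \<sigma>(2) in auto)
  ultimately have "(\<lambda>h. P *v (Q *v h)) = (\<lambda>h. h)"
    by (rule has_derivative_unique)
  then have PQ: "P *v (Q *v h) = h" for h
    by (rule fun_cong)
  have "((\<lambda>z. f (\<sigma> z)) has_derivative (\<lambda>h. J *v (P *v h))) (at 0)"
    using has_derivative_compose[OF P, of f] J \<sigma>(3) by simp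
  from has_derivative_compose[OF this, of \<sigma>] Q
  have "((\<lambda>z. \<sigma> (f (\<sigma> z))) has_derivative (\<lambda>h. Q *v (J *v (P *v h)))) (at 0)"
    using \<sigma>(3) a(2) by simp
  moreover have "(\<lambda>h. Q *v (J *v (P *v h))) = (*v) (Q ** J ** P)"
    by (simp add: fun_eq_iff matrix_vector_mul_assoc matrix_mul_assoc)
  ultimately have "((\<lambda>z. \<sigma> (f (\<sigma> z))) has_derivative (*v) (Q ** J ** P)) (at 0)"
    by simp
  moreover have "Q *v v \<noteq> 0"
    using PQ[of v] v(1) by auto
  moreover have "(Q ** J ** P) *v (Q *v v) = c *s (Q *v v)"
    by (simp add: matrix_vector_mul_assoc[symmetric] PQ v(2) vec.scale)
  ultimately show thesis by (rule that)
qed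

lemma unimodular_contraction_semigroup_2:
  fixes M :: "complex ^ 2 ^ 2"
  assumes contr: "\<And>z. norm (M *v z) \<le> norm z"
    and compl: "\<And>u w. M *v u = c *s u \<Longrightarrow> norm u = 1 \<Longrightarrow> hermitian w u = 0 \<Longrightarrow> hermitian (M *v w) u = 0"
    and v: "v \<noteq> 0" "M *v v = c *s v" "cmod c = 1"
    and inj: "\<And>z. M *v z = 0 \<Longrightarrow> z = 0"
  obtains L :: "real \<Rightarrow> complex ^ 2 ^ 2" where
    "\<And>z. L 0 *v z = z" "\<And>s t z. L (t + s) *v z = L t *v (L s *v z)" "L 1 = M"
    "\<And>t z. 0 \<le> t \<Longrightarrow> norm (L t *v z) \<le> norm z"
    "continuous_on UNIV (\<lambda>(t, z). L t *v z)"
proof -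
  define u where "u = of_real (inverse (norm v)) *s v"
  have u: "norm u = 1" "M *v u = c *s u"
    using v by (simp_all add: u_def norm_smult norm_inverse vec.scale mult.commute)
  obtain w where w: "norm w = 1" "hermitian w u = 0"
    "\<And>z. z = hermitian z u *s u + hermitian z w *s w"
    using orthonormal_completion_2[OF u(1)] by metis
  define m where "m = hermitian (M *v w) w"
  have m: "M *v w = m *s w"
    using w(3)[of "M *v w"] compl[OF u(2,1) w(2)] by (simp add: m_def)
  have "w \<noteq> 0" using w(1) by auto
  then have m_pos: "0 < cmod m" using inj[of w] m by auto
  have m_le: "cmod m \<le> 1"
    using contr[of w] w(1) by (simp add: m norm_smult)
  have c: "0 < cmod c" "cmod c \<le> 1"
    using v(3) by simp_all
  show thesis
    by (rule diagonal_contraction_semigroup[OF u(1) w u(2) m c m_pos m_le]) (rule that)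
qed

lemma conjugate_linear_semigroup:
  fixes L :: "real \<Rightarrow> complex ^ 'n ^ 'n"
  assumes \<sigma>: "\<sigma> \<in> LFM" "\<And>z. norm z < 1 \<Longrightarrow> \<sigma> (\<sigma> z) = z"
    and L: "\<And>z. L 0 *v z = z" "\<And>s t z. L (t + s) *v z = L t *v (L s *v z)"
    "\<And>t z. 0 \<le> t \<Longrightarrow> norm (L t *v z) \<le> norm z"
    "continuous_on UNIV (\<lambda>(t, z). L t *v z)"
  shows "semigroup_on unit_ball (\<lambda>t z. \<sigma> (L t *v \<sigma> z))"
    "\<And>t. 0 \<le> t \<Longrightarrow> (\<lambda>z. \<sigma> (L t *v \<sigma> z)) \<in> LFM"
proof -
  show LFM: "(\<lambda>z. \<sigma> (L t *v \<sigma> z)) \<in> LFM" if "0 \<le> t" for t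
    using LFM_compose[OF LFM_compose[OF \<sigma>(1) linear_in_LFM[of "L t"]] \<sigma>(1)] L(3) that by simp
  have ball: "norm (L t *v \<sigma> z) < 1" if "0 \<le> t" "norm z < 1" for t z
    using L(3)[OF that(1)] LFM_norm_less[OF \<sigma>(1) that(2)] by (rule le_less_trans)
  have "continuous_on ({0..} \<times> unit_ball) (\<lambda>p. (fst p, \<sigma> (snd p)))"
    by (intro continuous_intros continuous_on_compose2[OF LFM_continuous_on[OF \<sigma>(1)]]) auto
  from continuous_on_compose2[OF L(4) this]
  have "continuous_on ({0..} \<times> unit_ball) (\<lambda>p. L (fst p) *v \<sigma> (snd p))"
    by simp
  moreover have "(\<lambda>p. L (fst p) *v \<sigma> (snd p)) ` ({0..} \<times> unit_ball) \<subseteq> unit_ball"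
    using ball by auto
  ultimately have "continuous_on ({0..} \<times> unit_ball) (\<lambda>(t, z). \<sigma> (L t *v \<sigma> z))"
    unfolding case_prod_beta by (rule continuous_on_compose2[OF LFM_continuous_on[OF \<sigma>(1)]])
  then have "continuous_map (top_of_set {0..}) (compact_open unit_ball) (\<lambda>t z. \<sigma> (L t *v \<sigma> z))"
    by (rule continuous_map_compact_open)
  then have "continuous_map (top_of_set {0..})
      (subtopology (compact_open unit_ball) {f. holomorphic_self_map unit_ball f}) (\<lambda>t z. \<sigma> (L t *v \<sigma> z))"
    using LFM by (auto simp: continuous_map_in_subtopology LFM_def)
  then show "semigroup_on unit_ball (\<lambda>t z. \<sigma> (L t *v \<sigma> z))"
    using \<sigma>(2) L(1,2) ball by (simp add: semigroup_on_def)
qed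

theorem corollary1p6:
  fixes \<phi> :: "complex ^ 2 \<Rightarrow> complex ^ 2" and z0 :: "complex ^ 2"
  assumes "\<phi> \<in> LFM" and "elliptic \<phi>"
    and "inj_on \<phi> unit_ball"
    and "z0 \<in> unit_ball" and "\<phi> z0 = z0"
    and "spectral_radius (jacobian \<phi> (at z0)) = 1"
  shows "\<exists>\<Phi> :: real \<Rightarrow> complex ^ 2 \<Rightarrow> complex ^ 2.
    semigroup_on unit_ball \<Phi> \<and> (\<forall>t\<ge>0. \<Phi> t \<in> LFM) \<and> (\<forall>z\<in>unit_ball. \<Phi> 1 z = \<phi> z)"
proof -
  have z0: "norm z0 < 1"
    using assms(4) by simp
  define \<sigma> where "\<sigma> = ball_involution z0"
  have \<sigma>: "\<sigma> \<in> LFM" "\<And>z. norm z < 1 \<Longrightarrow> \<sigma> (\<sigma> z) = z" "\<sigma> 0 = z0" "\<sigma> z0 = 0"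
    unfolding \<sigma>_def using ball_involution_LFM[OF z0 refl] ball_involution_involutive[OF z0 refl]
      ball_involution_zero[OF z0 refl] ball_involution_self[OF z0 refl] by auto
  obtain J where J: "(\<phi> has_derivative (*v) J) (at z0)"
    using LFM_has_derivative[OF assms(1) z0] by auto
  obtain c v where v: "cmod c = 1" "v \<noteq> 0" "J *v v = c *s v"
    using spectral_radius_attained[of J] assms(6) jacobian_eq[OF J] by metis
  define \<psi> where "\<psi> = (\<lambda>z. \<sigma> (\<phi> (\<sigma> z)))"
  obtain M u where M: "(\<psi> has_derivative (*v) M) (at 0)" "u \<noteq> 0" "M *v u = c *s u"
    using involution_conjugate_eigenvector[OF \<sigma> z0 assms(5) J v(2,3)] unfolding \<psi>_def by metis
  have \<psi>: "\<psi> \<in> LFM" "\<psi> 0 = 0"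
    unfolding \<psi>_def using LFM_compose[OF LFM_compose[OF \<sigma>(1) assms(1)] \<sigma>(1)] \<sigma>(3,4) assms(5)
    by simp_all
  note rigid = LFM_rigid_at_zero[OF \<psi> M v(1)]
  have unconj: "\<phi> z = \<sigma> (M *v \<sigma> z)" if z: "norm z < 1" for z
  proof -
    have "\<sigma> (M *v \<sigma> z) = \<sigma> (\<psi> (\<sigma> z))"
      using rigid(2)[OF LFM_norm_less[OF \<sigma>(1) z]] by simp
    also have "\<dots> = \<phi> z"
      using \<sigma>(2) z LFM_norm_less[OF assms(1) z] by (simp add: \<psi>_def)
    finally show ?thesis ..
  qed
  have inj: "z = 0" if "M *v z = 0" for z
  proof (rule ccontr)
    assume "z \<noteq> 0"
    define y where "y = of_real (1 / (2 * norm z)) *s z"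
    have y: "norm y < 1" "y \<noteq> 0" "M *v y = 0"
      using \<open>z \<noteq> 0\<close> that by (simp_all add: y_def norm_smult norm_divide norm_mult vec.scale)
    have "\<phi> (\<sigma> y) = \<phi> (\<sigma> 0)"
      using unconj[of "\<sigma> y"] unconj[of "\<sigma> 0"] y \<sigma>(2) LFM_norm_less[OF \<sigma>(1)] by simp
    then have "\<sigma> y = \<sigma> 0"
      using assms(3) y(1) LFM_norm_less[OF \<sigma>(1)] by (auto dest: inj_onD)
    then show False
      using \<sigma>(2)[of y] \<sigma>(2)[of 0] y by simp
  qed
  obtain L :: "real \<Rightarrow> complex ^ 2 ^ 2" where L:
    "\<And>z. L 0 *v z = z" "\<And>s t z. L (t + s) *v z = L t *v (L s *v z)" "L 1 = M"
    "\<And>t z. 0 \<le> t \<Longrightarrow> norm (L t *v z) \<le> norm z"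
    "continuous_on UNIV (\<lambda>(t, z). L t *v z)"
    by (rule unimodular_contraction_semigroup_2[OF rigid(1) _ M(2,3) v(1)]; rule rigid(3) inj that; assumption)
  show ?thesis
  proof (intro exI conjI ballI allI impI)
    show "semigroup_on unit_ball (\<lambda>t z. \<sigma> (L t *v \<sigma> z))"
      by (rule conjugate_linear_semigroup(1)[OF \<sigma>(1,2) L(1,2,4,5)])
    show "(\<lambda>z. \<sigma> (L t *v \<sigma> z)) \<in> LFM" if "0 \<le> t" for t
      by (rule conjugate_linear_semigroup(2)[OF \<sigma>(1,2) L(1,2,4,5) that])
    show "\<sigma> (L 1 *v \<sigma> z) = \<phi> z" if "z \<in> unit_ball" for z
      using unconj that by (simp add: L(3))
  qed
qed

end
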